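(* Let $\mathcal{F}\subseteq\{0,1\}^n$ and $\boldsymbol{x}\in[0,1]^n$. Let $$\mathcal{L}=\left\{[a_1,b_1)\cup\dots\cup[a_k,b_k): 0\le a_1<b_1<a_2<b_2<\dots<a_k<b_k\le 1,\ k\in\mathbb{N}\right\}$$ and, for $X=[a_1,b_1)\cup\dots\cup[a_k,b_k)\in\mathcal{L}$, let $\mu(X)=(b_1-a_1)+\dots+(b_k-a_k)$. Then $\boldsymbol{x}\in\operatorname{conv}(\mathcal{F})$ if and only if there are sets $X_1,\dots,X_n\in\mathcal{L}$ such that $\mu(X_i)=x_i$ for all $i\in[n]$, and $\{i\in[n]: t\in X_i\}\in\mathcal{F}$ for every $t\in[0,1)$.
   Context: $[n]=\{1,\dots,n\}$. A vector $\boldsymbol{\xi}\in\{0,1\}^n$ is identified with the subset $\{i\in[n]:\xi_i=1\}$ of $[n]$; in particular elements of $\mathcal{F}$ are identified with subsets of $[n]$. Here $\mathbb{N}$ includes $0$, so that $\emptyset\in\mathcal{L}$ (with $\mu(\emptyset)=0$). *)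

theory Defs
  imports "HOL-Analysis.Analysis"
begin

definition interval_rep :: "nat \<Rightarrow> (nat \<Rightarrow> real) \<Rightarrow> (nat \<Rightarrow> real) \<Rightarrow> bool" where
  "interval_rep k a b \<longleftrightarrow>
     (k \<ge> 1 \<longrightarrow> 0 \<le> a 1 \<and> b k \<le> 1) \<and>
     (\<forall>j\<in>{1..k}. a j < b j) \<and>
     (\<forall>j\<in>{1..<k}. b j < a (j + 1))"

definition interval_union :: "nat \<Rightarrow> (nat \<Rightarrow> real) \<Rightarrow> (nat \<Rightarrow> real) \<Rightarrow> real set" where
  "interval_union k a b = (\<Union>j\<in>{1..k}. {a j..<b j})"

definition \<L> :: "real set set" where
  "\<L> = {interval_union k a b | k a b. interval_rep k a b}"

text \<open>Only meaningful on \<open>\<L>\<close>; independence of the chosen representation is shown in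
  \<open>\<mu>_interval_union\<close> below.\<close>

definition \<mu> :: "real set \<Rightarrow> real" where
  "\<mu> X = (THE m. \<exists>k a b. interval_rep k a b \<and> X = interval_union k a b \<and>
                       m = (\<Sum>j=1..k. b j - a j))"

definition support_set :: "real ^ 'n \<Rightarrow> 'n set" where
  "support_set \<xi> = {i. \<xi> $ i = 1}"

lemma interval_rep_less:
  assumes "interval_rep k a b" "1 \<le> i" "i < j" "j \<le> k"
  shows "b i < a j"
  using assms(3,4)
proof (induction j rule: less_induct)
  case (less j)
  show ?case
  proof (cases "j = i + 1")
    case True
    then show ?thesis using assms(1,2) less.prems by (auto simp: interval_rep_def)
  next
    case False
    define l where "l = j - 1"
    have l: "j = l + 1" "i < l" "l < j" "l < k" "1 \<le> l"
      using False less.prems assms(2) by (auto simp: l_def)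
    have "b i < a l" using less.IH[of l] l by simp
    also have "a l < b l" using assms(1) l by (auto simp: interval_rep_def)
    also have "b l < a j" using assms(1) l by (auto simp: interval_rep_def)
    finally show ?thesis .
  qed
qed

lemma measure_interval_union:
  assumes "interval_rep k a b"
  shows "measure lborel (interval_union k a b) = (\<Sum>j=1..k. b j - a j)"
proof -
  have disj: "{a i..<b i} \<inter> {a j..<b j} = {}" if "i \<in> {1..k}" "j \<in> {1..k}" "i < j" for i j
    using interval_rep_less[OF assms, of i j] that by auto
  have "disjoint_family_on (\<lambda>j. {a j..<b j}) {1..k}"
    unfolding disjoint_family_on_def
  proof (intro ballI impI)
    fix i j assume "i \<in> {1..k}" "j \<in> {1..k}" "i \<noteq> j"
    then show "{a i..<b i} \<inter> {a j..<b j} = {}"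
      using disj[of i j] disj[of j i] by (cases "i < j") (auto simp: Int_commute)
  qed
  moreover have le: "a j \<le> b j" if "j \<in> {1..k}" for j
    using assms that by (force simp: interval_rep_def)
  ultimately have "measure lborel (interval_union k a b)
      = (\<Sum>j=1..k. measure lborel {a j..<b j})"
    unfolding interval_union_def
    by (intro measure_finite_Union) auto
  also have "\<dots> = (\<Sum>j=1..k. b j - a j)"
    using le by (intro sum.cong) auto
  finally show ?thesis .
qed

lemma \<mu>_interval_union:
  assumes "interval_rep k a b"
  shows "\<mu> (interval_union k a b) = (\<Sum>j=1..k. b j - a j)"
  unfolding \<mu>_def
proof (rule the_equality)
  fix m
  assume "\<exists>k' a' b'. interval_rep k' a' b' \<and> interval_union k a b = interval_union k' a' b' \<and>
            m = (\<Sum>j=1..k'. b' j - a' j)"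
  then show "m = (\<Sum>j=1..k. b j - a j)"
    using measure_interval_union assms by metis
qed (use assms in blast)

end

theory Submission imports Defs begin

text \<open>If \<open>x\<close> is a convex combination of \<open>F\<close>, cut \<open>[0,1)\<close> into consecutive intervals whose lengths are
  the weights, and let \<open>X i\<close> collect the intervals belonging to vectors with \<open>i\<close>-th entry 1.
  Conversely, the weight of \<open>v \<in> F\<close> is the Lebesgue measure of the set of
  \<open>t\<close> with \<open>{i. t \<in> X i} = support_set v\<close>.\<close>

lemma empty_in_\<L>: "{} \<in> \<L>"
proof -
  have "interval_rep 0 a b \<and> {} = interval_union 0 a b" for a b
    by (simp add: interval_rep_def interval_union_def)
  then show ?thesis unfolding \<L>_def by blast
qed

lemma \<L>_measurable: "X \<in> \<L> \<Longrightarrow> X \<in> sets lborel"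
  by (auto simp: \<L>_def interval_union_def)

lemma \<L>_subset:
  assumes "X \<in> \<L>"
  shows "X \<subseteq> {0..<1}"
proof -
  obtain k a b where rep: "interval_rep k a b" and X: "X = interval_union k a b"
    using assms by (auto simp: \<L>_def)
  \<comment> \<open>\<open>interval_rep\<close> bounds only the outermost endpoints
    \<open>a 1\<close> and \<open>b k\<close>; the ordering of the intervals carries these bounds to
    every \<open>j\<close>.\<close>
  have "0 \<le> a j \<and> b j \<le> 1" if "j \<in> {1..k}" for j
  proof -
    have ends: "0 \<le> a 1" "b k \<le> 1" and less: "\<And>i. i \<in> {1..k} \<Longrightarrow> a i < b i"
      using rep that by (auto simp: interval_rep_def)
    have "0 \<le> a j"
      using interval_rep_less[OF rep, of 1 j] ends less[of 1] that by (cases "j = 1") auto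
    moreover have "b j \<le> 1"
      using interval_rep_less[OF rep, of j k] ends less[of k] that by (cases "j = k") auto
    ultimately show ?thesis ..
  qed
  then show ?thesis
    unfolding X interval_union_def by fastforce
qed

text \<open>Trades lengths computed from a representation for Lebesgue measure, so that additivity
  is available in both directions of the theorem.\<close>

lemma \<mu>_eq_measure: "X \<in> \<L> \<Longrightarrow> \<mu> X = measure lborel X"
  by (auto simp: \<L>_def \<mu>_interval_union measure_interval_union)

text \<open>Consecutive intervals of a representation must be separated by a gap. So if the last
  interval of \<open>X\<close> ends exactly at \<open>c\<close>, it is prolonged to
  \<open>d\<close>; otherwise a new interval is added after it.\<close>

lemma \<L>_append_interval:
  assumes "X \<in> \<L>" "X \<subseteq> {..<c}" "0 \<le> c" "c < d" "d \<le> 1"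
  shows "X \<union> {c..<d} \<in> \<L>"
proof -
  obtain k a b where rep: "interval_rep k a b" and X: "X = interval_union k a b"
    using assms(1) by (auto simp: \<L>_def)
  have "\<exists>k' a' b'. interval_rep k' a' b' \<and> X \<union> {c..<d} = interval_union k' a' b'"
  proof (cases "k = 0")
    case True
    then have "interval_rep 1 (\<lambda>_. c) (\<lambda>_. d) \<and> X \<union> {c..<d} = interval_union 1 (\<lambda>_. c) (\<lambda>_. d)"
      using assms X by (auto simp: interval_rep_def interval_union_def)
    then show ?thesis by blast
  next
    case False
    have ab: "a k < b k" using rep False by (auto simp: interval_rep_def)
    moreover have "{a k..<b k} \<subseteq> {..<c}"
      using False assms(2) X by (fastforce simp: interval_union_def)
    \<comment> \<open>If \<open>c < b k\<close>, the point \<open>max c (a k)\<close> would lie in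
      the last interval but not below \<open>c\<close>.\<close>
    ultimately have le: "b k \<le> c"
      using subsetD[of "{a k..<b k}" "{..<c}" "max c (a k)"] by (cases "c < b k") auto
    show ?thesis
    proof (cases "b k = c")
      case True
      have k: "{1..k} = insert k {1..<k}" using False by auto
      have "interval_rep k a (b(k := d))"
        using rep ab True assms unfolding interval_rep_def by auto
      moreover have "X \<union> {c..<d} = interval_union k a (b(k := d))"
        using ab True assms(4) unfolding X interval_union_def k by auto
      ultimately show ?thesis by blast
    next
      case False
      have k: "{1..Suc k} = insert (Suc k) {1..k}" by auto
      have "interval_rep (Suc k) (a(Suc k := c)) (b(Suc k := d))"
        using rep le False assms \<open>k \<noteq> 0\<close> unfolding interval_rep_def
        by (auto simp: less_Suc_eq)
      moreover have "X \<union> {c..<d} = interval_union (Suc k) (a(Suc k := c)) (b(Suc k := d))"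
        unfolding X interval_union_def k by auto
      ultimately show ?thesis by blast
    qed
  qed
  then show ?thesis by (auto simp: \<L>_def)
qed

lemma inj_on_support_set:
  assumes "F \<subseteq> {\<xi> :: real ^ 'n. \<forall>i. \<xi> $ i \<in> {0, 1}}"
  shows "inj_on support_set F"
proof (rule inj_onI)
  fix v w assume vw: "v \<in> F" "w \<in> F" "support_set v = support_set w"
  have "v $ i = w $ i" for i
  proof -
    have "v $ i = 1 \<longleftrightarrow> w $ i = 1" using vw(3) by (auto simp: support_set_def)
    moreover have "v $ i \<in> {0, 1}" "w $ i \<in> {0, 1}" using assms vw by auto
    ultimately show ?thesis by auto
  qed
  then show "v = w" by (simp add: vec_eq_iff)
qed

lemma finite_binary_vectors: "finite {\<xi> :: real ^ 'n. \<forall>i. \<xi> $ i \<in> {0, 1}}"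
  by (rule finite_imageD[OF finite_subset[OF subset_UNIV] inj_on_support_set]) auto

text \<open>The total weight may be less than 1, so that the induction can remove a vector from
  \<open>F\<close>. Keeping every \<open>X i\<close> below \<open>sum u F\<close> leaves the space
  to the right free for the interval of the next vector.\<close>

lemma exists_interval_family:
  fixes F :: "(real ^ 'n) set" and u :: "real ^ 'n \<Rightarrow> real"
  assumes "finite F" "F \<subseteq> {\<xi>. \<forall>i. \<xi> $ i \<in> {0, 1}}" "\<forall>v\<in>F. 0 \<le> u v" "sum u F \<le> 1"
  shows "\<exists>X. (\<forall>i. X i \<in> \<L> \<and> X i \<subseteq> {..<sum u F} \<and> measure lborel (X i) = (\<Sum>v\<in>F. u v *\<^sub>R v) $ i)
           \<and> (\<forall>t\<in>{0..<sum u F}. {i. t \<in> X i} \<in> support_set ` F)"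
  using assms
proof (induction F rule: finite_induct)
  case empty
  then show ?case using empty_in_\<L> by (intro exI[of _ "\<lambda>_. {}"]) auto
next
  case (insert v F)
  define c where "c = sum u F"
  have uv: "0 \<le> u v" and c: "0 \<le> c" and sum: "sum u (insert v F) = c + u v"
    using insert.prems insert.hyps by (auto simp: c_def intro: sum_nonneg)
  have c1: "c + u v \<le> 1" using insert.prems sum by simp
  obtain X where X: "\<And>i. X i \<in> \<L>" "\<And>i. X i \<subseteq> {..<c}"
      "\<And>i. measure lborel (X i) = (\<Sum>v\<in>F. u v *\<^sub>R v) $ i"
      "\<And>t. t \<in> {0..<c} \<Longrightarrow> {i. t \<in> X i} \<in> support_set ` F"
  proof -
    have "F \<subseteq> {\<xi>. \<forall>i. \<xi> $ i \<in> {0, 1}}" "\<forall>v\<in>F. 0 \<le> u v" "sum u F \<le> 1"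
      using insert.prems c1 uv by (auto simp: c_def)
    from insert.IH[OF this] show ?thesis
      using that unfolding c_def by blast
  qed
  define Y where "Y i = (if v $ i = 1 then X i \<union> {c..<c + u v} else X i)" for i
  \<comment> \<open>For \<open>u v = 0\<close> the added interval is empty and
    \<open>Y i = X i\<close>; appending is used only for positive weight.\<close>
  have "Y i \<in> \<L>" for i
    using X(1)[of i] \<L>_append_interval[OF X(1,2) c _ c1, of i] uv
    by (cases "u v = 0") (auto simp: Y_def)
  moreover have "Y i \<subseteq> {..<c + u v}" for i
  proof -
    have "X i \<subseteq> {..<c + u v}" by (rule order_trans[OF X(2)]) (use uv in simp)
    then show ?thesis by (auto simp: Y_def)
  qed
  moreover have "measure lborel (Y i) = (\<Sum>v\<in>insert v F. u v *\<^sub>R v) $ i" for i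
  proof -
    have "emeasure lborel (X i) \<noteq> \<infinity>"
      using emeasure_mono[OF \<L>_subset[OF X(1)[of i]], of lborel] by (auto simp: top_unique)
    moreover have "X i \<inter> {c..<c + u v} = {}"
      using X(2)[of i] by force
    ultimately have "measure lborel (X i \<union> {c..<c + u v}) = measure lborel (X i) + u v"
      using uv \<L>_measurable[OF X(1)[of i]] by (subst measure_Union) auto
    moreover have "v $ i \<in> {0, 1}" using insert.prems by auto
    ultimately show ?thesis using insert.hyps X(3)[of i] by (auto simp: Y_def)
  qed
  moreover have "{i. t \<in> Y i} \<in> support_set ` insert v F" if t: "t \<in> {0..<c + u v}" for t
  proof (cases "t < c")
    case True
    then have "{i. t \<in> Y i} = {i. t \<in> X i}" by (auto simp: Y_def)
    then show ?thesis using X(4)[of t] t True by auto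
  next
    case False
    \<comment> \<open>No \<open>X i\<close> reaches \<open>t \<ge> c\<close>, so only the new
      interval can put \<open>t\<close> into \<open>Y i\<close>.\<close>
    then have "{i. t \<in> Y i} = support_set v"
      using subsetD[OF X(2), of t] t by (auto simp: Y_def support_set_def)
    then show ?thesis by simp
  qed
  ultimately show ?case unfolding sum by blast
qed

text \<open>The sets \<open>T v\<close> with \<open>v \<in> F\<close> partition
  \<open>{0..<1}\<close>, so their measures sum to 1. Each \<open>X i\<close> is the union of those
  \<open>T v\<close> with \<open>v $ i = 1\<close>, so its measure is the \<open>i\<close>-th
  coordinate of the weighted sum.\<close>

lemma convex_weights_of_interval_family:
  fixes F :: "(real ^ 'n) set" and X :: "'n \<Rightarrow> real set"
  assumes F: "finite F" "F \<subseteq> {\<xi>. \<forall>i. \<xi> $ i \<in> {0, 1}}"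
    and X: "\<And>i. X i \<in> sets lborel" "\<And>i. X i \<subseteq> {0..<1}"
    and supp: "\<And>t. t \<in> {0..<1} \<Longrightarrow> {i. t \<in> X i} \<in> support_set ` F"
  shows "(\<chi> i. measure lborel (X i)) \<in> convex hull F"
proof -
  define T where "T v = {t \<in> {0..<1}. {i. t \<in> X i} = support_set v}" for v :: "real ^ 'n"
  have T: "T v \<in> sets lborel" for v
  proof -
    \<comment> \<open>Prescribing the membership of \<open>t\<close> in every \<open>X i\<close> is
      a finite intersection of measurable conditions, one per index.\<close>
    define C where "C i = (if i \<in> support_set v then X i else - X i)" for i
    have "C i \<in> sets lborel" for i
      using X(1)[of i] by (auto simp: C_def)
    then have "(\<Inter>i. C i) \<in> sets lborel"
      by (intro sets.finite_INT) simp_all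
    moreover have "T v = {0..<1} \<inter> (\<Inter>i. C i)"
      by (auto simp: T_def C_def split: if_splits)
    ultimately show ?thesis by simp
  qed
  have disj: "disjoint_family_on T F"
    unfolding disjoint_family_on_def
  proof (intro ballI impI)
    fix v w assume "v \<in> F" "w \<in> F" "v \<noteq> w"
    then have "support_set v \<noteq> support_set w"
      using inj_onD[OF inj_on_support_set[OF F(2)]] by blast
    then show "T v \<inter> T w = {}" unfolding T_def by blast
  qed
  \<comment> \<open>Used twice: \<open>A = {0..<1}\<close> gives the total weight,
    \<open>A = X i\<close> gives the coordinates.\<close>
  have part: "measure lborel A = (\<Sum>v\<in>F. measure lborel (T v \<inter> A))"
    if A: "A \<in> sets lborel" "A \<subseteq> {0..<1}" for A
  proof -
    have "A = (\<Union>v\<in>F. T v \<inter> A)" using A(2) supp unfolding T_def by blast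
    moreover have "measure lborel (\<Union>v\<in>F. T v \<inter> A) = (\<Sum>v\<in>F. measure lborel (T v \<inter> A))"
    proof (rule measure_finite_Union)
      show "disjoint_family_on (\<lambda>v. T v \<inter> A) F"
        using disj by (auto simp: disjoint_family_on_def)
      show "emeasure lborel (T v \<inter> A) \<noteq> \<infinity>" for v
        using emeasure_mono[OF le_infI2[OF A(2)], of lborel "T v"] by (auto simp: top_unique)
    qed (use F T A in auto)
    ultimately show ?thesis by simp
  qed
  have "(\<Sum>v\<in>F. measure lborel (T v)) = 1"
  proof -
    have "T v \<inter> {0..<1} = T v" for v by (auto simp: T_def)
    then show ?thesis using part[of "{0..<1}"] by simp
  qed
  moreover have "(\<Sum>v\<in>F. measure lborel (T v) *\<^sub>R v) = (\<chi> i. measure lborel (X i))"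
  proof -
    \<comment> \<open>By definition of \<open>T v\<close>, the set \<open>X i\<close> either
      contains \<open>T v\<close> or misses it, according to the entry \<open>v $ i\<close>.\<close>
    have "measure lborel (T v \<inter> X i) = measure lborel (T v) * v $ i" if "v \<in> F" for v i
    proof -
      have "v $ i \<in> {0, 1}" using that F by auto
      moreover have "T v \<inter> X i = (if v $ i = 1 then T v else {})"
        by (auto simp: T_def support_set_def)
      ultimately show ?thesis by auto
    qed
    then show ?thesis using part[OF X] by (simp add: vec_eq_iff)
  qed
  ultimately show ?thesis
    unfolding convex_hull_finite[OF F(1)]
    by (auto intro!: exI[of _ "\<lambda>v. measure lborel (T v)"])
qed

theorem theorem4:
  fixes F :: "(real ^ 'n) set" and x :: "real ^ 'n"
  assumes "F \<subseteq> {\<xi>. \<forall>i. \<xi> $ i \<in> {0, 1}}"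
    and "\<forall>i. x $ i \<in> {0..1}"
  shows "x \<in> convex hull F \<longleftrightarrow>
    (\<exists>X :: 'n \<Rightarrow> real set.
       (\<forall>i. X i \<in> \<L>) \<and>
       (\<forall>i. \<mu> (X i) = x $ i) \<and>
       (\<forall>t\<in>{0..<1}. {i. t \<in> X i} \<in> support_set ` F))"
    (is "_ \<longleftrightarrow> ?R")
proof
  have F: "finite F" by (rule finite_subset[OF assms(1) finite_binary_vectors])
  show ?R if "x \<in> convex hull F"
  proof -
    obtain u where u: "\<forall>v\<in>F. 0 \<le> u v" "sum u F = 1" "(\<Sum>v\<in>F. u v *\<^sub>R v) = x"
      using \<open>x \<in> convex hull F\<close> unfolding convex_hull_finite[OF F] by auto
    \<comment> \<open>As \<open>sum u F = 1\<close>, the intervals fill all of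
      \<open>{0..<1}\<close>.\<close>
    show ?thesis
      using exists_interval_family[OF F assms(1), of u] u \<mu>_eq_measure by auto
  qed
  show "x \<in> convex hull F" if ?R
  proof -
    obtain X where X: "\<And>i. X i \<in> \<L>" "\<And>i. \<mu> (X i) = x $ i"
        "\<And>t. t \<in> {0..<1} \<Longrightarrow> {i. t \<in> X i} \<in> support_set ` F"
      using \<open>?R\<close> by blast
    have "x = (\<chi> i. measure lborel (X i))"
      using X \<mu>_eq_measure by (simp add: vec_eq_iff)
    then show ?thesis
      using convex_weights_of_interval_family[OF F assms(1) \<L>_measurable \<L>_subset] X by metis
  qed
qed

end
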